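(* Let $\alpha>-1$ and $\beta>-1$. With the total energy $E$, the family $\mathcal{F}$, the quantities $m(K)$ and the extremal value $E^*=\sup\{m(K): K\in\mathcal{F}\}$ defined in the context, $E^*<+\infty$, and this value is attained at a unique $n$-tuple $X^*=\{x_1^*,\dots,x_n^*\}$, characterized by the fact that $x_i^*$ are precisely the zeros of the Jacobi polynomial $P_n^{(\alpha,\beta)}$.
   Context: The Jacobi polynomial is $$P_n^{(\alpha,\beta)}(x)=2^{-n}\sum_{k=0}^n\binom{n+\alpha}{n-k}\binom{n+\beta}{k}(x-1)^k(x+1)^{n-k}.$$ Two positive charges of mass $(\beta+1)/2$ and $(\alpha+1)/2$ are fixed at $-1$ and $+1$, respectively. For a discrete system $X=\{x_1,\dots,x_n\}$ of $n$ points of $\mathbb{C}$ (positive unit charges, with logarithmic interaction), the total energy is $$E(X)=-\sum_{1\le k<j\le n}\ln|x_k-x_j|+\sum_{k=1}^n\varphi(x_k),\qquad \varphi(x)=-\frac{\beta+1}{2}\ln|x+1|-\frac{\alpha+1}{2}\ln|x-1|,$$ where $E(X)=+\infty$ in case of coincidence of any two points. $\mathcal{F}$ denotes the family of compact continua in $\mathbb{C}$ containing both $-1$ and $+1$. For any $K\in\mathcal{F}$ set $$m(K)=\inf\{E(X): X=\{x_1,\dots,x_n\}\subset K\},$$ and consider the extremal problem $$E^*=\sup\{m(K): K\in\mathcal{F}\}.$$ *)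

theory Defs
  imports "HOL-Analysis.Analysis" "HOL-Computational_Algebra.Computational_Algebra"
begin

definition jacobi_poly :: "nat \<Rightarrow> real \<Rightarrow> real \<Rightarrow> complex poly" where
  "jacobi_poly n \<alpha> \<beta> =
     smult (1 / 2 ^ n)
       (\<Sum>k\<le>n. smult (of_real (((real n + \<alpha>) gchoose (n - k)) * ((real n + \<beta>) gchoose k)))
                  ([:-1, 1:] ^ k * [:1, 1:] ^ (n - k)))"

text \<open>
  The logarithm of a nonnegative real with the convention that the logarithm of 0 is minus
  infinity (the library has \<open>ln 0 = 0\<close> on the reals).
\<close>

definition elog :: "real \<Rightarrow> ereal" where
  "elog r = (if r = 0 then -\<infinity> else ereal (ln r))"

definition ext_field :: "real \<Rightarrow> real \<Rightarrow> complex \<Rightarrow> ereal" where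
  "ext_field \<alpha> \<beta> x =
     - (ereal ((\<beta> + 1) / 2) * elog (cmod (x + 1)))
     - (ereal ((\<alpha> + 1) / 2) * elog (cmod (x - 1)))"

text \<open>
  A system of points is a list, so that points may coincide. For \<open>\<alpha>, \<beta> > -1\<close> no
  \<open>\<infinity> - \<infinity>\<close> arises, and the energy is \<open>\<infinity>\<close> exactly if two points coincide or one of them is
  \<open>1\<close> or \<open>-1\<close>; see \<open>energy_infinite\<close> and \<open>energy_finite\<close> below.
\<close>

definition energy :: "real \<Rightarrow> real \<Rightarrow> complex list \<Rightarrow> ereal" where
  "energy \<alpha> \<beta> xs =
     - (\<Sum>j<length xs. \<Sum>k<j. elog (cmod (xs ! k - xs ! j)))
     + (\<Sum>k<length xs. ext_field \<alpha> \<beta> (xs ! k))"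

definition continua :: "complex set set" where
  "continua = {K. compact K \<and> connected K \<and> -1 \<in> K \<and> 1 \<in> K}"

definition systems :: "nat \<Rightarrow> complex set \<Rightarrow> complex list set" where
  "systems n K = {xs. length xs = n \<and> set xs \<subseteq> K}"

definition min_energy :: "real \<Rightarrow> real \<Rightarrow> nat \<Rightarrow> complex set \<Rightarrow> ereal" where
  "min_energy \<alpha> \<beta> n K = (INF xs\<in>systems n K. energy \<alpha> \<beta> xs)"

definition maxmin_energy :: "real \<Rightarrow> real \<Rightarrow> nat \<Rightarrow> ereal" where
  "maxmin_energy \<alpha> \<beta> n = (SUP K\<in>continua. min_energy \<alpha> \<beta> n K)"

text \<open>
  The energy does not depend on the order of the points, so minimizing systems are collected up
  to reordering, i.e. as multisets.
\<close>

definition minimizers :: "real \<Rightarrow> real \<Rightarrow> nat \<Rightarrow> complex set \<Rightarrow> complex multiset set" where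
  "minimizers \<alpha> \<beta> n K = mset ` {xs \<in> systems n K. energy \<alpha> \<beta> xs = min_energy \<alpha> \<beta> n K}"

definition extremal_continua :: "real \<Rightarrow> real \<Rightarrow> nat \<Rightarrow> complex set set" where
  "extremal_continua \<alpha> \<beta> n = {K \<in> continua. min_energy \<alpha> \<beta> n K = maxmin_energy \<alpha> \<beta> n}"

text \<open>
  The extremal value is attained at \<open>X\<close> if it is the minimal energy of some continuum, and
  \<open>X\<close> realizes it on every such continuum. Asking this of just one extremal continuum would not
  determine \<open>X\<close>: for \<open>n = 1\<close>, \<open>\<alpha> = \<beta> = 0\<close> the lemniscate region \<open>{x. cmod (x\<^sup>2 - 1) \<le> 1}\<close> is
  an extremal continuum, and all of its boundary points, not only the zero \<open>0\<close> of the Jacobi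
  polynomial, have the minimal energy \<open>0\<close>.
\<close>

definition maxmin_attained_at :: "real \<Rightarrow> real \<Rightarrow> nat \<Rightarrow> complex multiset \<Rightarrow> bool" where
  "maxmin_attained_at \<alpha> \<beta> n X \<longleftrightarrow>
     extremal_continua \<alpha> \<beta> n \<noteq> {} \<and>
     (\<forall>K\<in>extremal_continua \<alpha> \<beta> n. X \<in> minimizers \<alpha> \<beta> n K)"

lemma ext_field_finite:
  assumes "x \<noteq> -1" "x \<noteq> 1"
  shows "ext_field \<alpha> \<beta> x =
    ereal (- ((\<beta> + 1) / 2) * ln (cmod (x + 1)) - (\<alpha> + 1) / 2 * ln (cmod (x - 1)))"
  using assms by (simp add: ext_field_def elog_def add_eq_0_iff2)

lemma ext_field_infinite:
  assumes "\<alpha> > -1" "\<beta> > -1" "x = -1 \<or> x = 1"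
  shows "ext_field \<alpha> \<beta> x = \<infinity>"
  using assms by (auto simp: ext_field_def elog_def)

lemma energy_finite:
  assumes "distinct xs" "-1 \<notin> set xs" "1 \<notin> set xs"
  shows "energy \<alpha> \<beta> xs = ereal
    (- (\<Sum>j<length xs. \<Sum>k<j. ln (cmod (xs ! k - xs ! j)))
     + (\<Sum>k<length xs. - ((\<beta> + 1) / 2) * ln (cmod (xs ! k + 1))
                       - (\<alpha> + 1) / 2 * ln (cmod (xs ! k - 1))))"
proof -
  have "(\<Sum>j<length xs. \<Sum>k<j. elog (cmod (xs ! k - xs ! j))) =
        (\<Sum>j<length xs. \<Sum>k<j. ereal (ln (cmod (xs ! k - xs ! j))))"
    using assms(1) by (intro sum.cong refl) (auto simp: elog_def nth_eq_iff_index_eq)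
  moreover have "(\<Sum>k<length xs. ext_field \<alpha> \<beta> (xs ! k)) =
        (\<Sum>k<length xs. ereal (- ((\<beta> + 1) / 2) * ln (cmod (xs ! k + 1))
                       - (\<alpha> + 1) / 2 * ln (cmod (xs ! k - 1))))"
    using assms(2,3) by (intro sum.cong refl ext_field_finite) (metis lessThan_iff nth_mem)+
  ultimately show ?thesis
    unfolding energy_def by (simp add: sum_ereal)
qed

lemma sum_ereal_not_MInfty:
  fixes f :: "'a \<Rightarrow> ereal"
  assumes "finite A" "\<And>i. i \<in> A \<Longrightarrow> f i \<noteq> -\<infinity>"
  shows "sum f A \<noteq> -\<infinity>"
  using assms by (induction A rule: finite_induct) auto

lemma energy_infinite:
  assumes "\<alpha> > -1" "\<beta> > -1" "\<not> distinct xs \<or> -1 \<in> set xs \<or> 1 \<in> set xs"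
  shows "energy \<alpha> \<beta> xs = \<infinity>"
proof -
  let ?S = "\<Sum>j<length xs. \<Sum>k<j. elog (cmod (xs ! k - xs ! j))"
  let ?F = "\<Sum>k<length xs. ext_field \<alpha> \<beta> (xs ! k)"
  have ef: "ext_field \<alpha> \<beta> x \<noteq> -\<infinity>" for x
    by (cases "x = -1 \<or> x = 1")
      (use ext_field_infinite[OF assms(1,2), of x] ext_field_finite[of x] in auto)
  have S: "?S \<noteq> \<infinity>"
    by (auto simp: sum_Pinfty elog_def)
  have F: "?F \<noteq> -\<infinity>"
    by (rule sum_ereal_not_MInfty) (auto simp: ef)
  show ?thesis
  proof (cases "distinct xs")
    case True
    with assms(3) obtain i where "i < length xs" "xs ! i = -1 \<or> xs ! i = 1"
      by (metis in_set_conv_nth)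
    hence "?F = \<infinity>"
      using ext_field_infinite[OF assms(1,2)] by (auto simp: sum_Pinfty)
    thus ?thesis using S unfolding energy_def by (cases ?S) auto
  next
    case False
    then obtain k j where kj: "k < j" "j < length xs" "xs ! k = xs ! j"
      by (auto simp: distinct_conv_nth) (metis linorder_neqE_nat)
    have "(\<Sum>i<j. - elog (cmod (xs ! i - xs ! j))) = \<infinity>"
      using kj by (auto simp: sum_Pinfty elog_def)
    hence "(\<Sum>j<length xs. \<Sum>k<j. - elog (cmod (xs ! k - xs ! j))) = \<infinity>"
      using kj(2) by (auto simp: sum_Pinfty)
    moreover have "(\<Sum>j<length xs. \<Sum>k<j. - elog (cmod (xs ! k - xs ! j))) = - ?S"
    proof -
      have neg: "(\<Sum>i\<in>A. - f i) = - (\<Sum>i\<in>A. f i)"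
        if "finite A" "\<And>i. i \<in> A \<Longrightarrow> f i \<noteq> \<infinity>" for A :: "nat set" and f :: "nat \<Rightarrow> ereal"
        using that
      proof (induction A rule: finite_induct)
        case (insert a A)
        hence "f a \<noteq> \<infinity>" "sum f A \<noteq> \<infinity>" by (auto simp: sum_Pinfty)
        thus ?case using insert by (cases "f a"; cases "sum f A") auto
      qed simp
      have "(\<Sum>k<j. - elog (cmod (xs ! k - xs ! j))) =
            - (\<Sum>k<j. elog (cmod (xs ! k - xs ! j)))" for j
        by (rule neg) (auto simp: elog_def)
      thus ?thesis by (simp add: neg sum_Pinfty elog_def)
    qed
    ultimately show ?thesis using F unfolding energy_def by (cases ?F) auto
  qed
qed

end

theory Submission
  imports Defs
begin

text \<open>
  Minimizing the energy means maximizing the product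
  \<open>\<Prod>\<bar>x\<^sub>k - x\<^sub>j\<bar> \<cdot> \<Prod>\<bar>x\<^sub>k + 1\<bar>\<^bsup>(\<beta>+1)/2\<^esup> \<bar>x\<^sub>k - 1\<bar>\<^bsup>(\<alpha>+1)/2\<^esup>\<close>
  of weighted mutual distances. Every factor can only grow when points of the real axis are moved
  vertically in the plane, and since a continuum through \<open>-1\<close> and \<open>1\<close> projects onto a set of
  reals that contains \<open>[-1, 1]\<close>, every system on \<open>[-1, 1]\<close> lifts vertically to every such
  continuum (\<open>energy_vertical_lift\<close>, \<open>continuum_Re_surj\<close>). Hence the segment has the largest
  minimal energy. The factors \<open>\<bar>x\<^sub>k + 1\<bar>\<close> grow strictly as soon as a point leaves the real axis, and
  their exponent is positive, so a continuum with the same minimal energy must contain a minimal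
  system of the segment itself, and that system is minimal there too.

  It remains to see that the segment has exactly one minimal system, the zeros of the Jacobi
  polynomial. This is a classical argument of Stieltjes. A minimal system exists by compactness
  (\<open>min_energy_attained\<close>). Its points are distinct and interior, so the derivative of the energy in
  each of them vanishes (\<open>minimizer_equilibrium\<close>). If \<open>P\<close> is the monic polynomial with these
  zeros, then the sum of the \<open>1 / (x\<^sub>i - x\<^sub>j)\<close> is \<open>P'' / (2 P')\<close> at \<open>x\<^sub>i\<close>, so that
  \<open>(1 - x\<^sup>2) P'' + (\<beta> - \<alpha> - (\<alpha> + \<beta> + 2) x) P'\<close> vanishes at all zeros of \<open>P\<close>. Having no larger
  degree than \<open>P\<close>, it is a multiple of \<open>P\<close>, which is the Jacobi differential equation
  (\<open>equilibrium_imp_ode\<close>). The Jacobi polynomial solves the same equation (\<open>jacobi_poly_ode\<close>), and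
  its polynomial solutions are unique up to a factor because the eigenvalues belonging to different
  degrees are different (\<open>jacobi_solution_unique\<close>). Thus uniqueness
  of the minimal system comes from uniqueness of the polynomial.
\<close>

section \<open>The Jacobi differential operator\<close>

definition jacobi_op :: "complex \<Rightarrow> complex \<Rightarrow> complex poly \<Rightarrow> complex poly" where
  "jacobi_op a b p = [:1, 0, -1:] * pderiv (pderiv p) + [:b - a, - (a + b + 2):] * pderiv p"

text \<open>
  The operator maps \<open>x\<^sup>m\<close> to minus this number times \<open>x\<^sup>m\<close> plus lower powers, so the Jacobi
  equation of degree \<open>m\<close> reads \<open>jacobi_op a b y + jacobi_eigenvalue a b m \<cdot> y = 0\<close>.
\<close>

definition jacobi_eigenvalue :: "complex \<Rightarrow> complex \<Rightarrow> nat \<Rightarrow> complex" where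
  "jacobi_eigenvalue a b m = of_nat m * (of_nat m + a + b + 1)"

lemma jacobi_op_linear:
  "jacobi_op a b (p + q) = jacobi_op a b p + jacobi_op a b q"
  "jacobi_op a b (smult c p) = smult c (jacobi_op a b p)"
  "jacobi_op a b 0 = 0"
  by (simp_all add: jacobi_op_def pderiv_add pderiv_smult ring_distribs smult_add_right)

lemma jacobi_op_sum:
  "jacobi_op a b (\<Sum>i\<in>I. f i) = (\<Sum>i\<in>I. jacobi_op a b (f i))"
  by (induction I rule: infinite_finite_induct) (simp_all add: jacobi_op_linear)

lemma coeff_jacobi_op_top:
  assumes "degree p \<le> m"
  shows "coeff (jacobi_op a b p) m = - jacobi_eigenvalue a b m * coeff p m"
proof -
  have zero: "coeff p k = 0" if "m < k" for k
    using assms that by (intro coeff_eq_0) simp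
  consider "m = 0" | "m = 1" | k where "m = Suc (Suc k)"
    by (metis One_nat_def not0_implies_Suc)
  thus ?thesis
    by cases (simp_all add: jacobi_op_def jacobi_eigenvalue_def coeff_pderiv zero algebra_simps)
qed

lemma degree_jacobi_op_le: "degree (jacobi_op a b p) \<le> degree p"
proof (rule degree_le, intro allI impI)
  fix i assume "degree p < i"
  thus "coeff (jacobi_op a b p) i = 0"
    using coeff_jacobi_op_top[of p i a b] by (simp add: coeff_eq_0)
qed

text \<open>
  The difference of the two eigenvalues is \<open>(n - m) (n + m + \<alpha> + \<beta> + 1)\<close>, and the second factor
  is positive because \<open>n + m \<ge> 1\<close> and \<open>\<alpha> + \<beta> > -2\<close>.
\<close>

lemma jacobi_eigenvalue_inj:
  assumes "\<alpha> > -1" "\<beta> > -1" "m < n"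
  shows "jacobi_eigenvalue (of_real \<alpha>) (of_real \<beta>) m \<noteq> jacobi_eigenvalue (of_real \<alpha>) (of_real \<beta>) n"
proof
  assume "jacobi_eigenvalue (of_real \<alpha>) (of_real \<beta>) m = jacobi_eigenvalue (of_real \<alpha>) (of_real \<beta>) n"
  hence "complex_of_real (real m * (real m + \<alpha> + \<beta> + 1)) = of_real (real n * (real n + \<alpha> + \<beta> + 1))"
    by (simp add: jacobi_eigenvalue_def)
  hence "real m * (real m + \<alpha> + \<beta> + 1) = real n * (real n + \<alpha> + \<beta> + 1)"
    by (simp only: of_real_eq_iff)
  hence "(real n - real m) * (real n + real m + \<alpha> + \<beta> + 1) = 0"
    by (simp add: algebra_simps)
  thus False using assms by auto
qed

text \<open>
  Comparing leading coefficients shows that a nonzero polynomial solution of the equation with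
  eigenvalue index \<open>n\<close> has degree exactly \<open>n\<close>.
\<close>

lemma jacobi_solution_degree_less:
  assumes "\<alpha> > -1" "\<beta> > -1"
    and ode: "jacobi_op (of_real \<alpha>) (of_real \<beta>) p
              + smult (jacobi_eigenvalue (of_real \<alpha>) (of_real \<beta>) n) p = 0"
    and small: "p = 0 \<or> degree p < n"
  shows "p = 0"
proof (rule ccontr)
  assume "p \<noteq> 0"
  let ?ev = "jacobi_eigenvalue (of_real \<alpha>) (of_real \<beta>)"
  have "coeff (jacobi_op (of_real \<alpha>) (of_real \<beta>) p + smult (?ev n) p) (degree p)
        = (?ev n - ?ev (degree p)) * lead_coeff p"
    by (simp add: coeff_jacobi_op_top algebra_simps)
  thus False
    using ode jacobi_eigenvalue_inj[OF assms(1,2), of "degree p" n] small \<open>p \<noteq> 0\<close> by simp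
qed

text \<open>
  Subtracting the right multiple of the monic solution leaves a solution of smaller degree.
\<close>

lemma jacobi_solution_unique:
  assumes "\<alpha> > -1" "\<beta> > -1"
    and p: "jacobi_op (of_real \<alpha>) (of_real \<beta>) p
              + smult (jacobi_eigenvalue (of_real \<alpha>) (of_real \<beta>) n) p = 0" "degree p \<le> n"
    and q: "jacobi_op (of_real \<alpha>) (of_real \<beta>) q
              + smult (jacobi_eigenvalue (of_real \<alpha>) (of_real \<beta>) n) q = 0" "degree q \<le> n"
    and monic: "coeff p n = 1"
  shows "q = smult (coeff q n) p"
proof -
  let ?d = "q + smult (- coeff q n) p"
  let ?L = "\<lambda>p. jacobi_op (of_real \<alpha>) (of_real \<beta>) p
              + smult (jacobi_eigenvalue (of_real \<alpha>) (of_real \<beta>) n) p"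
  \<comment> \<open>the equation is linear\<close>
  have "?L ?d = ?L q + smult (- coeff q n) (?L p)"
    by (simp only: jacobi_op_linear smult_add_right smult_smult mult.commute add_ac)
  hence "?L ?d = 0" using p q by simp
  moreover have "?d = 0 \<or> degree ?d < n"
  proof -
    have "degree ?d \<le> n" using p q
      by (intro degree_add_le) (auto intro: order.trans[OF degree_smult_le])
    moreover have "coeff ?d n = 0" by (simp add: monic)
    ultimately show ?thesis
      by (metis leading_coeff_0_iff le_neq_implies_less)
  qed
  ultimately have "?d = 0" by (rule jacobi_solution_degree_less[OF assms(1,2)])
  thus ?thesis by simp
qed

section \<open>The Jacobi polynomial as an eigenvector\<close>

text \<open>
  With \<open>U = x - 1\<close> and \<open>V = x + 1\<close> one has \<open>1 - x\<^sup>2 = - U V\<close> and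
  \<open>b - a - (a + b + 2) x = - (a + 1) V - (b + 1) U\<close>, so the operator maps \<open>U\<^sup>i V\<^sup>j\<close> to a combination
  of itself and its two neighbours \<open>U\<^bsup>i-1\<^esup> V\<^bsup>j+1\<^esup>\<close> and \<open>U\<^bsup>i+1\<^esup> V\<^bsup>j-1\<^esup>\<close>. The right-hand side
  groups this combination into differences of neighbours, to be summed by telescoping. For
  \<open>i = 0\<close> or \<open>j = 0\<close> the truncated exponent is harmless, as its coefficient is zero.
\<close>

lemma jacobi_op_basis:
  fixes i j :: nat and a b :: complex
  defines "U \<equiv> [:-1, 1:]" and "V \<equiv> [:1, 1:]"
  shows "jacobi_op a b (U ^ i * V ^ j) + smult (jacobi_eigenvalue a b (i + j)) (U ^ i * V ^ j)
       = smult (of_nat i * (of_nat i + a)) (U ^ i * V ^ j - U ^ (i - 1) * V ^ (j + 1))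
       - smult (of_nat j * (of_nat j + b)) (U ^ (i + 1) * V ^ (j - 1) - U ^ i * V ^ j)"
proof -
  define A B where "A = U ^ i" and "B = V ^ j"
  define I J Ca Cb where "I = [:of_nat i :: complex:]" and "J = [:of_nat j :: complex:]"
    and "Ca = [:a:]" and "Cb = [:b:]"
  have dU: "pderiv U = 1" and dV: "pderiv V = 1"
    by (simp_all add: U_def V_def pderiv_pCons)
  have dA: "pderiv (U ^ k) = [:of_nat k:] * U ^ (k - 1)"
    and dB: "pderiv (V ^ k) = [:of_nat k:] * V ^ (k - 1)" for k
    by (cases k; simp add: pderiv_power_Suc dU dV del: power_Suc)+
  \<comment> \<open>Both \<open>A\<close> and \<open>B\<close> are eigenvectors of an Euler operator; differentiating once more also gives the second derivatives, and then only ring identities are left.\<close>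
  have A1: "U * pderiv A = I * A" and B1: "V * pderiv B = J * B"
    unfolding A_def B_def I_def J_def dA dB by (cases i; simp; fail) (cases j; simp; fail)
  have "pderiv (U * pderiv A) = pderiv (I * A)" "pderiv (V * pderiv B) = pderiv (J * B)"
    by (simp_all only: A1 B1)
  hence A2: "pderiv A + U * pderiv (pderiv A) = I * pderiv A"
    and B2: "pderiv B + V * pderiv (pderiv B) = J * pderiv B"
    by (simp_all add: pderiv_mult dU dV I_def J_def pderiv_smult algebra_simps)
  have AV: "U ^ (i - 1) * V ^ (j + 1) * I = V * pderiv A * B"
    and BU: "U ^ (i + 1) * V ^ (j - 1) * J = U * A * pderiv B"
    by (simp_all add: A_def B_def dA dB I_def J_def mult_ac)
  have sm: "smult c p = [:c:] * p" for c :: complex and p by simp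
  have ev: "[:jacobi_eigenvalue a b (i + j):] = (I + J) * (I + J + Ca + Cb + 1)"
    and ci: "[:of_nat i * (of_nat i + a):] = I * (I + Ca)"
    and cj: "[:of_nat j * (of_nat j + b):] = J * (J + Cb)"
    by (simp_all add: I_def J_def Ca_def Cb_def jacobi_eigenvalue_def one_pCons)
  have q: "[:1, 0, -1:] = - (U * V)" and l: "[:b - a, - (a + b + 2):] = - ((Ca + 1) * V + (Cb + 1) * U)"
    by (simp_all add: U_def V_def Ca_def Cb_def one_pCons)
  have d2: "pderiv (pderiv (A * B)) = pderiv (pderiv A) * B + 2 * pderiv A * pderiv B + A * pderiv (pderiv B)"
    by (simp add: pderiv_mult pderiv_add algebra_simps)
  have "jacobi_op a b (A * B) + (I + J) * (I + J + Ca + Cb + 1) * (A * B)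
    = (I + Ca) * (I * (A * B) - V * pderiv A * B)
    - (J + Cb) * (U * A * pderiv B - J * (A * B))"
    unfolding jacobi_op_def d2 q l unfolding pderiv_mult using A1 A2 B1 B2 by algebra
  also have "\<dots> = I * (I + Ca) * (A * B - U ^ (i - 1) * V ^ (j + 1))
     - J * (J + Cb) * (U ^ (i + 1) * V ^ (j - 1) - A * B)"
    unfolding AV[symmetric] BU[symmetric] by algebra
  finally show ?thesis unfolding sm ev ci cj A_def B_def .
qed

definition jacobi_coeff :: "nat \<Rightarrow> real \<Rightarrow> real \<Rightarrow> nat \<Rightarrow> real" where
  "jacobi_coeff n \<alpha> \<beta> k = ((real n + \<alpha>) gchoose (n - k)) * ((real n + \<beta>) gchoose k)"

lemma Suc_mult_gbinomial_Suc:
  "real (Suc k) * (x gchoose Suc k) = (x - real k) * (x gchoose k)" for x :: real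
  using gbinomial_absorption[of k x] gbinomial_absorb_comp[of x k] by simp

text \<open>
  This ratio of consecutive coefficients is what makes the neighbouring contributions of
  \<open>jacobi_op_basis\<close> cancel.
\<close>

lemma jacobi_coeff_Suc:
  assumes "k < n"
  shows "jacobi_coeff n \<alpha> \<beta> (Suc k) * (real (Suc k) * (real (Suc k) + \<alpha>))
       = jacobi_coeff n \<alpha> \<beta> k * (real (n - k) * (real (n - k) + \<beta>))"
proof -
  obtain m where m: "n = Suc (k + m)"
    using assms less_imp_Suc_add by blast
  have 1: "real (Suc m) * ((real n + \<alpha>) gchoose Suc m) = (real (Suc k) + \<alpha>) * ((real n + \<alpha>) gchoose m)"
    using Suc_mult_gbinomial_Suc[of m "real n + \<alpha>"] by (simp add: m add_ac)
  have 2: "real (Suc k) * ((real n + \<beta>) gchoose Suc k) = (real (Suc m) + \<beta>) * ((real n + \<beta>) gchoose k)"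
    using Suc_mult_gbinomial_Suc[of k "real n + \<beta>"] by (simp add: m add_ac)
  have nk: "n - Suc k = m" "n - k = Suc m" using m by auto
  have "((real n + \<alpha>) gchoose m) * ((real n + \<beta>) gchoose Suc k) * (real (Suc k) * (real (Suc k) + \<alpha>))
      = ((real n + \<alpha>) gchoose Suc m) * ((real n + \<beta>) gchoose k) * (real (Suc m) * (real (Suc m) + \<beta>))"
    using 1 2 by algebra
  thus ?thesis unfolding jacobi_coeff_def nk .
qed

text \<open>
  Weighted with its coefficient, the \<open>k\<close>-th summand of the Jacobi polynomial contributes a
  difference \<open>D k - D (Suc k)\<close>, and the sum telescopes to zero.
\<close>

lemma jacobi_poly_ode:
  "jacobi_op (of_real \<alpha>) (of_real \<beta>) (jacobi_poly n \<alpha> \<beta>)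
   + smult (jacobi_eigenvalue (of_real \<alpha>) (of_real \<beta>) n) (jacobi_poly n \<alpha> \<beta>) = 0"
proof -
  define T :: "nat \<Rightarrow> nat \<Rightarrow> complex poly" where "T i j = [:-1, 1:] ^ i * [:1, 1:] ^ j" for i j
  let ?c = "\<lambda>k. complex_of_real (jacobi_coeff n \<alpha> \<beta> k)"
  let ?L = "\<lambda>p. jacobi_op (of_real \<alpha>) (of_real \<beta>) p
              + smult (jacobi_eigenvalue (of_real \<alpha>) (of_real \<beta>) n) p"
  \<comment> \<open>The case distinction sets \<open>D (Suc n) = 0\<close>: the coefficient formula need not vanish at \<open>k = n + 1\<close>, where \<open>n - k\<close> is truncated.\<close>
  define D where "D k = (if k \<le> n then smult (of_real (jacobi_coeff n \<alpha> \<beta> k * (real k * (real k + \<alpha>))))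
      (T k (n - k) - T (k - 1) (Suc n - k)) else 0)" for k
  have L_smult: "?L (smult c p) = smult c (?L p)" for c p
    by (simp add: jacobi_op_linear smult_add_right mult.commute)
  have L_sum: "?L (\<Sum>k\<in>I. f k) = (\<Sum>k\<in>I. ?L (f k))" for I :: "nat set" and f
    by (induction I rule: infinite_finite_induct) (simp_all add: jacobi_op_linear smult_add_right)
  have step: "?L (smult (?c k) (T k (n - k))) = D k - D (Suc k)" if "k \<le> n" for k
  proof -
    have "?L (T k (n - k)) = 
        smult (of_nat k * (of_nat k + of_real \<alpha>)) (T k (n - k) - T (k - 1) (Suc n - k))
      - smult (of_nat (n - k) * (of_nat (n - k) + of_real \<beta>)) (T (Suc k) (n - Suc k) - T k (n - k))"
      using jacobi_op_basis[of "of_real \<alpha>" "of_real \<beta>" k "n - k"] that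
      by (simp add: T_def Suc_diff_le del: power_Suc)
    hence "?L (smult (?c k) (T k (n - k))) = D k - 
        smult (of_real (jacobi_coeff n \<alpha> \<beta> k * (real (n - k) * (real (n - k) + \<beta>))))
          (T (Suc k) (n - Suc k) - T k (n - k))"
      unfolding L_smult using that by (simp add: D_def smult_diff_right del: of_nat_diff)
    also have "smult (of_real (jacobi_coeff n \<alpha> \<beta> k * (real (n - k) * (real (n - k) + \<beta>))))
          (T (Suc k) (n - Suc k) - T k (n - k)) = D (Suc k)"
    proof (cases "k < n")
      case True
      show ?thesis unfolding jacobi_coeff_Suc[OF True, symmetric]
        using True by (simp add: D_def)
    qed (use that in \<open>simp add: D_def\<close>)
    finally show ?thesis .
  qed
  have "?L (\<Sum>k\<le>n. smult (?c k) (T k (n - k))) = (\<Sum>k\<le>n. D k - D (Suc k))"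
    unfolding L_sum by (intro sum.cong refl step) auto
  also have "\<dots> = D 0 - D (Suc n)" by (rule sum_telescope)
  also have "\<dots> = 0" by (simp add: D_def)
  finally show ?thesis
    unfolding jacobi_poly_def L_smult by (simp add: jacobi_coeff_def T_def)
qed

text \<open>
  All the products \<open>(x - 1)\<^sup>k (x + 1)\<^bsup>n-k\<^esup>\<close> are monic of degree \<open>n\<close>, so the coefficient of \<open>x\<^sup>n\<close> is
  a Vandermonde convolution of binomial coefficients.
\<close>

lemma jacobi_poly_degree_le: "degree (jacobi_poly n \<alpha> \<beta>) \<le> n"
  and coeff_jacobi_poly:
    "coeff (jacobi_poly n \<alpha> \<beta>) n = of_real (((2 * real n + \<alpha> + \<beta>) gchoose n) / 2 ^ n)"
proof -
  define T :: "nat \<Rightarrow> complex poly" where "T k = [:-1, 1:] ^ k * [:1, 1:] ^ (n - k)" for k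
  have deg: "degree (T k) = n" if "k \<le> n" for k
    using that by (simp add: T_def degree_mult_eq degree_power_eq)
  have lc: "coeff (T k) n = 1" if "k \<le> n" for k
  proof -
    have "lead_coeff (T k) = 1" by (simp add: T_def lead_coeff_mult lead_coeff_power)
    thus ?thesis using deg[OF that] by simp
  qed
  have J: "jacobi_poly n \<alpha> \<beta> = smult (1 / 2 ^ n)
       (\<Sum>k\<le>n. smult (of_real (((real n + \<alpha>) gchoose (n - k)) * ((real n + \<beta>) gchoose k))) (T k))"
    by (simp add: jacobi_poly_def T_def)
  show "degree (jacobi_poly n \<alpha> \<beta>) \<le> n"
    unfolding J using deg
    by (intro order.trans[OF degree_smult_le] degree_sum_le) auto
  have "coeff (jacobi_poly n \<alpha> \<beta>) n =
     of_real ((\<Sum>k\<le>n. ((real n + \<beta>) gchoose k) * ((real n + \<alpha>) gchoose (n - k))) / 2 ^ n)"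
    unfolding J by (simp add: coeff_sum lc mult.commute)
  also have "(\<Sum>k\<le>n. ((real n + \<beta>) gchoose k) * ((real n + \<alpha>) gchoose (n - k)))
      = (real n + \<beta> + (real n + \<alpha>)) gchoose n"
    using gbinomial_Vandermonde[of "real n + \<beta>" "real n + \<alpha>" n] by (simp add: atMost_atLeast0)
  also have "real n + \<beta> + (real n + \<alpha>) = 2 * real n + \<alpha> + \<beta>" by simp
  finally show "coeff (jacobi_poly n \<alpha> \<beta>) n = of_real (((2 * real n + \<alpha> + \<beta>) gchoose n) / 2 ^ n)" .
qed

text \<open>
  The numerator of the binomial coefficient is the product of the \<open>2 n + \<alpha> + \<beta> - i\<close> for \<open>i < n\<close>;
  these exceed \<open>2 n - 2 - (n - 1) \<ge> 0\<close>.
\<close>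

lemma coeff_jacobi_poly_nonzero:
  assumes "\<alpha> > -1" "\<beta> > -1"
  shows "coeff (jacobi_poly n \<alpha> \<beta>) n \<noteq> 0"
proof -
  have "2 * real n + \<alpha> + \<beta> - real i \<noteq> 0" if "i < n" for i
    using that assms by linarith
  hence "(\<Prod>i = 0..<n. 2 * real n + \<alpha> + \<beta> - real i) \<noteq> 0" by simp
  hence "(2 * real n + \<alpha> + \<beta>) gchoose n \<noteq> 0"
    by (metis gbinomial_mult_fact mult_zero_right)
  thus ?thesis by (simp add: coeff_jacobi_poly)
qed

section \<open>Existence of minimal systems\<close>

text \<open>
  The exponential of minus the energy. Unlike the energy it is a real-valued function that is
  continuous everywhere, and it takes functions on \<open>nat\<close> as arguments because these carry a
  product topology, for which Tychonoff's theorem gives compactness.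
\<close>

definition gap_product :: "real \<Rightarrow> real \<Rightarrow> nat \<Rightarrow> (nat \<Rightarrow> complex) \<Rightarrow> real" where
  "gap_product \<alpha> \<beta> n x =
     (\<Prod>j<n. \<Prod>k<j. cmod (x k - x j)) *
     (\<Prod>k<n. cmod (x k + 1) powr ((\<beta> + 1) / 2) * cmod (x k - 1) powr ((\<alpha> + 1) / 2))"

lemma gap_product_nonneg: "gap_product \<alpha> \<beta> n x \<ge> 0"
  unfolding gap_product_def by (intro mult_nonneg_nonneg prod_nonneg) auto

lemma elog_mono: "0 \<le> r \<Longrightarrow> r \<le> s \<Longrightarrow> elog r \<le> elog s"
  by (auto simp: elog_def)

lemma gap_product_eq_0_iff:
  "gap_product \<alpha> \<beta> (length xs) (\<lambda>i. xs ! i) = 0 \<longleftrightarrow> \<not> distinct xs \<or> -1 \<in> set xs \<or> 1 \<in> set xs"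
proof -
  have "(\<exists>j<length xs. \<exists>k<j. xs ! k = xs ! j) \<longleftrightarrow> \<not> distinct xs"
  proof
    assume "\<not> distinct xs"
    then obtain i j where "i < length xs" "j < length xs" "i \<noteq> j" "xs ! i = xs ! j"
      by (auto simp: distinct_conv_nth)
    thus "\<exists>j<length xs. \<exists>k<j. xs ! k = xs ! j"
      by (metis linorder_neqE_nat)
  qed (auto simp: nth_eq_iff_index_eq)
  moreover have "(\<exists>k<length xs. xs ! k = -1 \<or> xs ! k = 1) \<longleftrightarrow> -1 \<in> set xs \<or> 1 \<in> set xs"
    unfolding in_set_conv_nth by blast
  ultimately show ?thesis
    by (auto simp: gap_product_def prod_zero_iff add_eq_0_iff2 Bex_def)
qed

lemma energy_eq_elog:
  assumes "\<alpha> > -1" "\<beta> > -1"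
  shows "energy \<alpha> \<beta> xs = - elog (gap_product \<alpha> \<beta> (length xs) (\<lambda>i. xs ! i))"
proof (cases "gap_product \<alpha> \<beta> (length xs) (\<lambda>i. xs ! i) = 0")
  case True
  thus ?thesis
    using energy_infinite[OF assms] by (simp add: gap_product_eq_0_iff elog_def)
next
  case False
  hence xs: "distinct xs" "-1 \<notin> set xs" "1 \<notin> set xs"
    by (simp_all add: gap_product_eq_0_iff)
  have ne: "xs ! k \<noteq> -1" "xs ! k \<noteq> 1" if "k < length xs" for k
    using that xs nth_mem by metis+
  let ?P = "\<Prod>j<length xs. \<Prod>k<j. cmod (xs ! k - xs ! j)"
  let ?W = "\<lambda>k. cmod (xs ! k + 1) powr ((\<beta> + 1) / 2) * cmod (xs ! k - 1) powr ((\<alpha> + 1) / 2)"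
  have "ln (\<Prod>k<length xs. ?W k) = (\<Sum>k<length xs. ln (?W k))"
    using ne by (intro ln_prod) (auto simp: add_eq_0_iff2)
  also have "\<dots> = (\<Sum>k<length xs. (\<beta> + 1) / 2 * ln (cmod (xs ! k + 1))
                        + (\<alpha> + 1) / 2 * ln (cmod (xs ! k - 1)))"
    using ne by (intro sum.cong refl) (simp add: ln_mult ln_powr add_eq_0_iff2)
  finally have W: "ln (\<Prod>k<length xs. ?W k) = \<dots>" .
  have "ln ?P = (\<Sum>j<length xs. ln (\<Prod>k<j. cmod (xs ! k - xs ! j)))"
    using xs(1) by (intro ln_prod) (auto simp: prod_zero_iff nth_eq_iff_index_eq)
  also have "\<dots> = (\<Sum>j<length xs. \<Sum>k<j. ln (cmod (xs ! k - xs ! j)))"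
    using xs(1) by (intro sum.cong refl ln_prod) (auto simp: nth_eq_iff_index_eq)
  finally have P: "ln ?P = \<dots>" .
  have "ln (gap_product \<alpha> \<beta> (length xs) (\<lambda>i. xs ! i)) = ln ?P + ln (\<Prod>k<length xs. ?W k)"
    using False unfolding gap_product_def by (subst ln_mult) auto
  thus ?thesis
    unfolding energy_finite[OF xs] using False
    by (simp add: elog_def P W sum.distrib sum_negf sum_subtractf del: prod.distrib)
qed

lemma continuous_on_gap_product:
  assumes "\<alpha> > -1" "\<beta> > -1"
  shows "continuous_on S (gap_product \<alpha> \<beta> n)"
proof -
  have [continuous_intros]: "continuous_on S (\<lambda>x::nat \<Rightarrow> complex. x i)" for i
    by (rule continuous_on_subset[OF continuous_on_product_coordinates]) simp
  show ?thesis
    unfolding gap_product_def using assms by (intro continuous_intros continuous_on_powr') auto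
qed

lemma compact_functions_into:
  fixes K :: "complex set"
  assumes "compact K"
  shows "compact {x :: nat \<Rightarrow> complex. \<forall>i. x i \<in> K}"
proof -
  have "compactin (product_topology (\<lambda>i::nat. euclidean) UNIV) (PiE UNIV (\<lambda>i. K))"
    using assms by (simp add: compactin_PiE)
  thus ?thesis
    by (simp add: euclidean_product_topology PiE_UNIV_domain Pi_def)
qed

text \<open>
  A maximum of the continuous function \<open>gap_product\<close> over a compact set of sequences is a minimum of
  the energy over lists.
\<close>

lemma min_energy_attained:
  assumes "\<alpha> > -1" "\<beta> > -1" "compact K" "K \<noteq> {}"
  obtains xs where "xs \<in> systems n K" "energy \<alpha> \<beta> xs = min_energy \<alpha> \<beta> n K"
proof -
  let ?S = "{x :: nat \<Rightarrow> complex. \<forall>i. x i \<in> K}"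
  let ?V = "gap_product \<alpha> \<beta> n"
  obtain a where "a \<in> K" using assms(4) by blast
  hence "?S \<noteq> {}" by auto
  then obtain x where x: "x \<in> ?S" and max: "\<And>y. y \<in> ?S \<Longrightarrow> ?V y \<le> ?V x"
    using continuous_attains_sup[OF compact_functions_into[OF assms(3)] _ continuous_on_gap_product[OF assms(1,2)]]
    by blast
  have V_cong: "?V y = ?V z" if "\<And>i. i < n \<Longrightarrow> y i = z i" for y z
    unfolding gap_product_def using that by (intro arg_cong2[of _ _ _ _ "(*)"] prod.cong) auto
  define xs where "xs = map x [0..<n]"
  have xs: "xs \<in> systems n K" using x by (auto simp: systems_def xs_def)
  have "energy \<alpha> \<beta> xs \<le> energy \<alpha> \<beta> ys" if "ys \<in> systems n K" for ys
  proof -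
    \<comment> \<open>padding with a point of \<open>K\<close> keeps the sequence in the compact set\<close>
    define y where "y i = (if i < n then ys ! i else a)" for i
    have len: "length ys = n" and "y \<in> ?S"
      using that \<open>a \<in> K\<close> by (auto simp: systems_def y_def)
    hence "?V y \<le> ?V x" by (intro max)
    moreover have "?V y = ?V (\<lambda>i. ys ! i)" "?V x = ?V (\<lambda>i. xs ! i)"
      by (rule V_cong; simp add: y_def xs_def)+
    ultimately show ?thesis
      using len by (simp add: energy_eq_elog[OF assms(1,2)] elog_mono gap_product_nonneg xs_def)
  qed
  hence "energy \<alpha> \<beta> xs = min_energy \<alpha> \<beta> n K"
    unfolding min_energy_def by (intro antisym INF_greatest INF_lower xs) auto
  with xs show ?thesis by (rule that)
qed


section \<open>Minimal systems on the segment\<close>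

lemma energy_finite_iff:
  assumes "\<alpha> > -1" "\<beta> > -1"
  shows "energy \<alpha> \<beta> xs < \<infinity> \<longleftrightarrow> distinct xs \<and> -1 \<notin> set xs \<and> 1 \<notin> set xs"
proof (cases "distinct xs \<and> -1 \<notin> set xs \<and> 1 \<notin> set xs")
  case True
  thus ?thesis by (simp add: energy_finite)
next
  case False
  thus ?thesis using energy_infinite[OF assms, of xs] by auto
qed

abbreviation real_segment :: "complex set" where
  "real_segment \<equiv> of_real ` {-1..1}"

lemma real_segment_continuum: "real_segment \<in> continua"
proof -
  have c: "continuous_on {-1..1} (of_real :: real \<Rightarrow> complex)" by (intro continuous_intros)
  have "-1 \<in> real_segment" by (rule image_eqI[of _ _ "-1"]) auto
  moreover have "1 \<in> real_segment" by (rule image_eqI[of _ _ 1]) auto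
  ultimately show ?thesis
    by (auto simp: continua_def intro!: compact_continuous_image connected_continuous_image c)
qed

lemma of_real_interior:
  assumes "S \<subseteq> {-1 <..< 1}"
  shows "-1 \<notin> complex_of_real ` S" "1 \<notin> complex_of_real ` S"
proof -
  have "complex_of_real x \<noteq> -1 \<and> complex_of_real x \<noteq> 1" if "x \<in> S" for x
  proof -
    have "x \<noteq> -1" "x \<noteq> 1" using assms that by auto
    thus ?thesis by (metis of_real_1 of_real_eq_iff of_real_minus)
  qed
  thus "-1 \<notin> complex_of_real ` S" "1 \<notin> complex_of_real ` S"
    by (metis imageE)+
qed

text \<open>
  Any \<open>n\<close> distinct interior points of the segment have finite energy.
\<close>

lemma min_energy_segment_finite:
  assumes "\<alpha> > -1" "\<beta> > -1"
  shows "min_energy \<alpha> \<beta> n real_segment < \<infinity>"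
proof -
  have "infinite {-1 <..< (1::real)}" by simp
  then obtain S where S: "finite S" "card S = n" "S \<subseteq> {-1 <..< (1::real)}"
    using infinite_arbitrarily_large by blast
  then obtain ys where ys: "set ys = S" "distinct ys" "length ys = n"
    using finite_distinct_list distinct_card by metis
  let ?xs = "map complex_of_real ys"
  have "?xs \<in> systems n real_segment" using S ys by (force simp: systems_def)
  hence "min_energy \<alpha> \<beta> n real_segment \<le> energy \<alpha> \<beta> ?xs"
    unfolding min_energy_def by (rule INF_lower)
  also have "\<dots> < \<infinity>"
    unfolding energy_finite_iff[OF assms] using ys of_real_interior[OF S(3)]
    by (simp add: distinct_map inj_on_def)
  finally show ?thesis .
qed

lemma energy_of_real:
  fixes xs :: "real list"
  assumes "distinct xs" "set xs \<subseteq> {-1 <..< 1}"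
  shows "energy \<alpha> \<beta> (map of_real xs) = ereal
    (- (\<Sum>j<length xs. \<Sum>k<j. ln \<bar>xs ! k - xs ! j\<bar>)
     + (\<Sum>k<length xs. - ((\<beta> + 1) / 2) * ln \<bar>xs ! k + 1\<bar> - (\<alpha> + 1) / 2 * ln \<bar>xs ! k - 1\<bar>))"
proof -
  let ?ys = "map complex_of_real xs"
  have fx: "distinct ?ys" "-1 \<notin> set ?ys" "1 \<notin> set ?ys"
    using assms(1) of_real_interior[OF assms(2)] by (simp_all add: distinct_map inj_on_def)
  have cm: "cmod (of_real a - of_real b) = \<bar>a - b\<bar>" "cmod (of_real a + 1) = \<bar>a + 1\<bar>"
    "cmod (of_real a - 1) = \<bar>a - 1\<bar>" for a b
    by (metis norm_of_real of_real_diff of_real_add of_real_1)+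
  have "(\<Sum>j<length xs. \<Sum>k<j. ln (cmod (?ys ! k - ?ys ! j)))
      = (\<Sum>j<length xs. \<Sum>k<j. ln \<bar>xs ! k - xs ! j\<bar>)"
    by (intro sum.cong refl) (auto simp: cm)
  moreover have "(\<Sum>k<length xs. - ((\<beta> + 1) / 2) * ln (cmod (?ys ! k + 1))
                  - (\<alpha> + 1) / 2 * ln (cmod (?ys ! k - 1)))
      = (\<Sum>k<length xs. - ((\<beta> + 1) / 2) * ln \<bar>xs ! k + 1\<bar> - (\<alpha> + 1) / 2 * ln \<bar>xs ! k - 1\<bar>)"
    by (intro sum.cong refl) (auto simp: cm)
  ultimately show ?thesis
    unfolding energy_finite[OF fx] length_map by (simp only:)
qed


text \<open>
  Used to separate the interactions of one point from those among the others.
\<close>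

lemma sum_pairs_isolate:
  fixes f :: "nat \<Rightarrow> nat \<Rightarrow> 'a::comm_monoid_add"
  assumes "i < n" and sym: "\<And>j k. f k j = f j k"
  shows "(\<Sum>j<n. \<Sum>k<j. f k j) =
    (\<Sum>k\<in>{..<n}-{i}. f k i) + (\<Sum>j\<in>{..<n}-{i}. \<Sum>k\<in>{..<j}-{i}. f k j)"
proof -
  have inner: "(\<Sum>k<j. f k j) = (if i < j then f j i else 0) + (\<Sum>k\<in>{..<j}-{i}. f k j)" for j
    by (cases "i < j") (simp_all add: sum.remove[of "{..<j}" i] sym[of i])
  have "(\<Sum>j<n. \<Sum>k<j. f k j) = (\<Sum>k<i. f k i) + (\<Sum>j\<in>{..<n}-{i}. \<Sum>k<j. f k j)"
    using assms(1) by (intro sum.remove) auto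
  also have "(\<Sum>j\<in>{..<n}-{i}. \<Sum>k<j. f k j) =
     (\<Sum>j\<in>{..<n}-{i}. if i < j then f j i else 0) + (\<Sum>j\<in>{..<n}-{i}. \<Sum>k\<in>{..<j}-{i}. f k j)"
    unfolding inner by (rule sum.distrib)
  also have "(\<Sum>j\<in>{..<n}-{i}. if i < j then f j i else 0) = (\<Sum>j\<in>{i<..<n}. f j i)"
    by (rule sum.mono_neutral_cong_right) auto
  finally have "(\<Sum>j<n. \<Sum>k<j. f k j) = ((\<Sum>k<i. f k i) + (\<Sum>j\<in>{i<..<n}. f j i))
       + (\<Sum>j\<in>{..<n}-{i}. \<Sum>k\<in>{..<j}-{i}. f k j)"
    by (simp only: add_ac)
  also have "(\<Sum>k<i. f k i) + (\<Sum>j\<in>{i<..<n}. f j i) = (\<Sum>k\<in>{..<i} \<union> {i<..<n}. f k i)"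
    by (intro sum.union_disjoint[symmetric]) auto
  also have "{..<i} \<union> {i<..<n} = {..<n}-{i}" using assms(1) by auto
  finally show ?thesis .
qed

text \<open>
  The dependence of the energy on a single point, up to a constant.
\<close>

lemma energy_list_update:
  fixes xs :: "real list"
  assumes "i < length xs"
  obtains C where "\<And>t. distinct (xs[i := t]) \<Longrightarrow> set (xs[i := t]) \<subseteq> {-1 <..< 1} \<Longrightarrow>
    energy \<alpha> \<beta> (map of_real (xs[i := t])) = ereal (C -
      ((\<Sum>k\<in>{..<length xs}-{i}. ln \<bar>t - xs ! k\<bar>)
       + (\<beta> + 1) / 2 * ln \<bar>t + 1\<bar> + (\<alpha> + 1) / 2 * ln \<bar>t - 1\<bar>))"
proof -
  let ?n = "length xs"
  let ?I = "{..<?n}-{i}"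
  let ?W = "\<lambda>t. - ((\<beta> + 1) / 2) * ln \<bar>t + 1\<bar> - (\<alpha> + 1) / 2 * ln \<bar>t - 1\<bar>"
  let ?C = "- (\<Sum>j\<in>?I. \<Sum>k\<in>{..<j}-{i}. ln \<bar>xs ! k - xs ! j\<bar>) + (\<Sum>k\<in>?I. ?W (xs ! k))"
  show ?thesis
  proof (rule that[of ?C])
    fix t assume ys: "distinct (xs[i := t])" "set (xs[i := t]) \<subseteq> {-1 <..< 1}"
    let ?ys = "xs[i := t]"
    have "(\<Sum>j<?n. \<Sum>k<j. ln \<bar>?ys ! k - ?ys ! j\<bar>) =
        (\<Sum>k\<in>?I. ln \<bar>?ys ! k - ?ys ! i\<bar>) + (\<Sum>j\<in>?I. \<Sum>k\<in>{..<j}-{i}. ln \<bar>?ys ! k - ?ys ! j\<bar>)"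
      by (rule sum_pairs_isolate[OF assms]) (simp only: abs_minus_commute)
    also have "(\<Sum>k\<in>?I. ln \<bar>?ys ! k - ?ys ! i\<bar>) = (\<Sum>k\<in>?I. ln \<bar>t - xs ! k\<bar>)"
      using assms by (intro sum.cong refl) (auto simp: abs_minus_commute)
    also have "(\<Sum>j\<in>?I. \<Sum>k\<in>{..<j}-{i}. ln \<bar>?ys ! k - ?ys ! j\<bar>) =
        (\<Sum>j\<in>?I. \<Sum>k\<in>{..<j}-{i}. ln \<bar>xs ! k - xs ! j\<bar>)"
      by (intro sum.cong refl) auto
    finally have pairs: "(\<Sum>j<?n. \<Sum>k<j. ln \<bar>?ys ! k - ?ys ! j\<bar>) =
        (\<Sum>k\<in>?I. ln \<bar>t - xs ! k\<bar>) + (\<Sum>j\<in>?I. \<Sum>k\<in>{..<j}-{i}. ln \<bar>xs ! k - xs ! j\<bar>)" .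
    have "(\<Sum>k<?n. ?W (?ys ! k)) = ?W (?ys ! i) + (\<Sum>k\<in>?I. ?W (?ys ! k))"
      using assms by (intro sum.remove) auto
    also have "(\<Sum>k\<in>?I. ?W (?ys ! k)) = (\<Sum>k\<in>?I. ?W (xs ! k))"
      by (intro sum.cong refl) auto
    finally have field: "(\<Sum>k<?n. ?W (?ys ! k)) = ?W t + (\<Sum>k\<in>?I. ?W (xs ! k))"
      using assms by simp
    show "energy \<alpha> \<beta> (map of_real ?ys) = ereal (?C -
      ((\<Sum>k\<in>?I. ln \<bar>t - xs ! k\<bar>)
       + (\<beta> + 1) / 2 * ln \<bar>t + 1\<bar> + (\<alpha> + 1) / 2 * ln \<bar>t - 1\<bar>))"
      unfolding energy_of_real[OF ys] length_list_update pairs field by simp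
  qed
qed

lemma DERIV_ln_abs_diff:
  assumes "t \<noteq> (c::real)"
  shows "((\<lambda>t. ln \<bar>t - c\<bar>) has_real_derivative 1 / (t - c)) (at t)"
proof (cases "t > c")
  case True
  have "((\<lambda>t. ln (t - c)) has_real_derivative 1 / (t - c)) (at t)"
    using True by (auto intro!: derivative_eq_intros)
  thus ?thesis
    by (rule has_field_derivative_transform_within[where d = "t - c"])
       (use True in \<open>auto simp: dist_real_def\<close>)
next
  case False
  have "((\<lambda>t. ln (c - t)) has_real_derivative 1 / (t - c)) (at t)"
    using False assms by (auto intro!: derivative_eq_intros simp: divide_simps)
  thus ?thesis
    by (rule has_field_derivative_transform_within[where d = "c - t"])
       (use False assms in \<open>auto simp: dist_real_def\<close>)
qed

text \<open>
  Moving a single point of a minimal system a little keeps the points distinct and inside the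
  segment, so the part of the energy depending on this point has an interior extremum there. The
  equation says that the forces on the point balance.
\<close>

lemma minimizer_equilibrium:
  fixes xs :: "real list"
  assumes xs: "distinct xs" "set xs \<subseteq> {-1 <..< 1}"
    and min: "energy \<alpha> \<beta> (map of_real xs) = min_energy \<alpha> \<beta> (length xs) real_segment"
    and x: "x \<in> set xs"
  shows "(\<Sum>y\<in>set xs - {x}. 1 / (x - y)) + (\<beta> + 1) / 2 / (x + 1) + (\<alpha> + 1) / 2 / (x - 1) = 0"
proof -
  let ?n = "length xs"
  obtain i where i: "i < ?n" and xi: "xs ! i = x" using x by (auto simp: in_set_conv_nth)
  let ?I = "{..<?n}-{i}"
  define L where "L t = (\<Sum>k\<in>?I. ln \<bar>t - xs ! k\<bar>)
       + (\<beta> + 1) / 2 * ln \<bar>t + 1\<bar> + (\<alpha> + 1) / 2 * ln \<bar>t - 1\<bar>" for t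
  obtain C where C: "\<And>t. distinct (xs[i := t]) \<Longrightarrow> set (xs[i := t]) \<subseteq> {-1 <..< 1} \<Longrightarrow>
    energy \<alpha> \<beta> (map of_real (xs[i := t])) = ereal (C - L t)"
    using energy_list_update[OF i] unfolding L_def by blast
  have rest: "nth xs ` ?I = set xs - {x}"
  proof -
    have "inj_on (nth xs) {..<?n}" using xs(1) by (simp add: inj_on_nth)
    hence "nth xs ` ?I = nth xs ` {..<?n} - nth xs ` {i}"
      using i by (intro inj_on_image_set_diff) auto
    also have "nth xs ` {..<?n} = set xs" by (auto simp: set_conv_nth)
    finally show ?thesis by (simp add: xi)
  qed
  define N where "N = {-1 <..< 1} - (set xs - {x})"
  have "open N" unfolding N_def by (intro open_Diff finite_imp_closed) auto
  moreover have "x \<in> N" using x xs(2) by (auto simp: N_def)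
  ultimately obtain d where d: "d > 0" "ball x d \<subseteq> N"
    by (auto simp: open_contains_ball)
  have "L t \<le> L x" if "\<bar>x - t\<bar> < d" for t
  proof -
    have "t \<in> N" using that d(2) by (auto simp: dist_real_def)
    have "set (xs[i := t]) \<subseteq> {-1 <..< 1}"
      using xs(2) \<open>t \<in> N\<close> set_update_subset_insert[of xs i t] by (auto simp: N_def)
    moreover have "distinct (xs[i := t])"
      using xs(1) \<open>t \<in> N\<close> by (intro distinct_list_update) (auto simp: N_def xi)
    moreover note ys = calculation
    have "map complex_of_real (xs[i := t]) \<in> systems ?n real_segment"
      using ys(1) by (force simp: systems_def)
    hence "energy \<alpha> \<beta> (map of_real xs) \<le> energy \<alpha> \<beta> (map of_real (xs[i := t]))"
      unfolding min min_energy_def by (rule INF_lower)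
    moreover have "energy \<alpha> \<beta> (map of_real xs) = ereal (C - L x)"
      using C[of x] xs by (simp add: xi[symmetric])
    ultimately show ?thesis using C[of t] by simp
  qed
  moreover have "DERIV L x :> (\<Sum>k\<in>?I. 1 / (x - xs ! k)) + (\<beta> + 1) / 2 * (1 / (x + 1))
      + (\<alpha> + 1) / 2 * (1 / (x - 1))"
  proof -
    have "x \<noteq> xs ! k" if "k \<in> ?I" for k using that rest by blast
    moreover have "x \<noteq> -1" "x \<noteq> 1" using x xs(2) by auto
    ultimately show ?thesis
      unfolding L_def using DERIV_ln_abs_diff[of x "-1"]
      by (intro DERIV_add DERIV_cmult DERIV_sum DERIV_ln_abs_diff) auto
  qed
  ultimately have "(\<Sum>k\<in>?I. 1 / (x - xs ! k)) + (\<beta> + 1) / 2 * (1 / (x + 1))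
      + (\<alpha> + 1) / 2 * (1 / (x - 1)) = 0"
    using d(1) by (intro DERIV_local_max) auto
  moreover have "(\<Sum>y\<in>set xs - {x}. 1 / (x - y)) = (\<Sum>k\<in>?I. 1 / (x - xs ! k))"
    unfolding rest[symmetric] using xs(1)
    by (subst sum.reindex) (auto simp: inj_on_def nth_eq_iff_index_eq)
  ultimately show ?thesis by simp
qed

text \<open>
  Writing \<open>P = (x - z) Q\<close>, one has \<open>P'(z) = Q(z)\<close> and \<open>P''(z) = 2 Q'(z)\<close>, and the sum is the
  logarithmic derivative of \<open>Q\<close>.
\<close>

lemma second_derivative_at_root:
  fixes A :: "complex set"
  assumes "finite A" "z \<in> A"
  defines "P \<equiv> \<Prod>w\<in>A. [:-w, 1:]"
  shows "poly (pderiv (pderiv P)) z = 2 * poly (pderiv P) z * (\<Sum>w\<in>A-{z}. 1 / (z - w))"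
proof -
  define Q where "Q = (\<Prod>w\<in>A-{z}. [:-w, 1:])"
  have P: "P = [:-z, 1:] * Q"
    unfolding P_def Q_def using assms(1,2) by (rule prod.remove)
  have d: "pderiv [:-z, 1:] = 1" by (simp add: pderiv_pCons)
  have "poly (pderiv P) z = poly Q z" "poly (pderiv (pderiv P)) z = 2 * poly (pderiv Q) z"
    unfolding P by (simp_all only: pderiv_mult pderiv_add d) simp_all
  moreover have "poly (pderiv Q) z = poly Q z * (\<Sum>w\<in>A-{z}. 1 / (z - w))"
  proof -
    have "poly (pderiv Q) z = (\<Sum>w\<in>A-{z}. poly (prod (\<lambda>w. [:-w, 1:]) (A - {z} - {w})) z)"
      unfolding Q_def pderiv_prod by (simp add: poly_sum pderiv_pCons)
    also have "\<dots> = (\<Sum>w\<in>A-{z}. poly Q z * (1 / (z - w)))"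
    proof (rule sum.cong[OF refl])
      fix w assume w: "w \<in> A - {z}"
      have "Q = [:-w, 1:] * prod (\<lambda>w. [:-w, 1:]) (A - {z} - {w})"
        unfolding Q_def using assms(1) w by (intro prod.remove) auto
      hence "poly Q z = (z - w) * poly (prod (\<lambda>w. [:-w, 1:]) (A - {z} - {w})) z"
        by (simp only: poly_mult) simp
      moreover have "z - w \<noteq> 0" using w by auto
      ultimately show "poly (prod (\<lambda>w. [:-w, 1:]) (A - {z} - {w})) z = poly Q z * (1 / (z - w))"
        by simp
    qed
    finally show ?thesis by (simp only: sum_distrib_left)
  qed
  ultimately show ?thesis by simp
qed

text \<open>
  By the equilibrium equations the residual of the differential equation vanishes at all \<open>card A\<close>
  zeros of \<open>P\<close>; the choice of the eigenvalue removes its coefficient of degree \<open>card A\<close>. Hence it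
  is the zero polynomial.
\<close>

lemma equilibrium_imp_ode:
  fixes A :: "real set"
  assumes A: "finite A" "A \<subseteq> {-1 <..< 1}"
    and eq: "\<And>x. x \<in> A \<Longrightarrow>
      (\<Sum>y\<in>A - {x}. 1 / (x - y)) + (\<beta> + 1) / 2 / (x + 1) + (\<alpha> + 1) / 2 / (x - 1) = 0"
  defines "P \<equiv> \<Prod>x\<in>A. [:- complex_of_real x, 1:]"
  shows "jacobi_op (of_real \<alpha>) (of_real \<beta>) P
       + smult (jacobi_eigenvalue (of_real \<alpha>) (of_real \<beta>) (card A)) P = 0"
    and "degree P = card A" and "coeff P (card A) = 1"
proof -
  let ?R = "jacobi_op (of_real \<alpha>) (of_real \<beta>) P
       + smult (jacobi_eigenvalue (of_real \<alpha>) (of_real \<beta>) (card A)) P"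
  let ?Z = "complex_of_real ` A"
  have PZ: "P = (\<Prod>w\<in>?Z. [:-w, 1:])"
    unfolding P_def by (subst prod.reindex) (auto simp: inj_on_def)
  have "degree P = (\<Sum>x\<in>A. degree [:- complex_of_real x, 1:])"
    unfolding P_def by (intro degree_prod_eq_sum_degree) simp
  thus deg: "degree P = card A" by simp
  have "lead_coeff P = 1" unfolding P_def lead_coeff_prod by simp
  thus lc: "coeff P (card A) = 1" by (simp only: deg)
  have "poly ?R z = 0" if z: "z \<in> ?Z" for z
  proof -
    obtain x where x: "x \<in> A" "z = of_real x" using z by blast
    let ?S = "\<Sum>y\<in>A - {x}. 1 / (x - y)"
    have "x + 1 \<noteq> 0" "x - 1 \<noteq> 0" using x A(2) by auto
    hence "2 * (1 - x\<^sup>2) * ?S + ((\<beta> - \<alpha>) - (\<alpha> + \<beta> + 2) * x) = 0"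
      using eq[OF x(1)] by (simp add: field_simps) algebra
    hence "complex_of_real (2 * (1 - x\<^sup>2) * ?S + ((\<beta> - \<alpha>) - (\<alpha> + \<beta> + 2) * x)) = 0"
      by simp
    moreover have "(\<Sum>w\<in>?Z - {z}. 1 / (z - w)) = of_real ?S"
    proof -
      have "?Z - {z} = complex_of_real ` (A - {x})" using x(2) by auto
      thus ?thesis by (simp add: sum.reindex inj_on_def x(2))
    qed
    ultimately have e: "2 * (1 - z\<^sup>2) * (\<Sum>w\<in>?Z - {z}. 1 / (z - w))
        + ((of_real \<beta> - of_real \<alpha>) - (of_real \<alpha> + of_real \<beta> + 2) * z) = 0"
      using x(2) by (simp add: of_real_power)
    have d2: "poly (pderiv (pderiv P)) z = 2 * poly (pderiv P) z * (\<Sum>w\<in>?Z-{z}. 1 / (z - w))"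
      unfolding PZ using A(1) that by (intro second_derivative_at_root) auto
    have "poly P z = 0"
      unfolding PZ poly_prod using A(1) that by (auto simp: prod_zero_iff)
    hence "poly ?R z = (1 - z\<^sup>2) * poly (pderiv (pderiv P)) z
        + ((of_real \<beta> - of_real \<alpha>) - (of_real \<alpha> + of_real \<beta> + 2) * z) * poly (pderiv P) z"
      by (simp add: jacobi_op_def power2_eq_square algebra_simps)
    also have "\<dots> = poly (pderiv P) z * 0"
      unfolding d2 e[symmetric] by (simp only: algebra_simps)
    finally show ?thesis by simp
  qed
  moreover have "degree ?R \<le> card A"
    using degree_jacobi_op_le[of "of_real \<alpha>" "of_real \<beta>" P] deg
    by (intro degree_add_le) (auto intro: order.trans[OF degree_smult_le])
  moreover have "coeff ?R (card A) = 0"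
    by (simp add: coeff_jacobi_op_top deg lc)
  moreover have "card ?Z = card A" by (intro card_image) (auto simp: inj_on_def)
  ultimately show "?R = 0"
    by (intro poly_eqI_degree_lead_coeff[where n = "card A" and A = ?Z]) auto
qed

text \<open>
  Every minimal system of the segment, not just one of them, is the system of zeros of the Jacobi
  polynomial, as its monic polynomial satisfies the Jacobi equation.
\<close>

lemma segment_minimizer_zeros:
  assumes "\<alpha> > -1" "\<beta> > -1"
    and zs: "zs \<in> systems n real_segment" "energy \<alpha> \<beta> zs = min_energy \<alpha> \<beta> n real_segment"
  obtains xs :: "real list" where "zs = map of_real xs" "distinct xs" "set xs \<subseteq> {-1 <..< 1}"
    "mset zs = proots (jacobi_poly n \<alpha> \<beta>)"
proof -
  define xs where "xs = map Re zs"
  have "energy \<alpha> \<beta> zs < \<infinity>" unfolding zs(2) by (rule min_energy_segment_finite[OF assms(1,2)])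
  hence fin: "distinct zs" "-1 \<notin> set zs" "1 \<notin> set zs"
    unfolding energy_finite_iff[OF assms(1,2)] by auto
  have sub: "set zs \<subseteq> real_segment" and len: "length zs = n" using zs(1) by (auto simp: systems_def)
  have zs_xs: "zs = map of_real xs"
    using sub by (auto simp: xs_def comp_def intro!: nth_equalityI) (metis Re_complex_of_real imageE nth_mem subsetD)
  have dist: "distinct xs" using fin(1) unfolding zs_xs by (simp add: distinct_map)
  have inI: "set xs \<subseteq> {-1 <..< 1}"
  proof
    fix x assume x: "x \<in> set xs"
    hence "of_real x \<in> set zs" by (simp add: zs_xs)
    hence "x \<noteq> -1" "x \<noteq> 1" "of_real x \<in> real_segment" using fin(2,3) sub by auto
    thus "x \<in> {-1 <..< 1}" by auto
  qed
  have card: "card (set xs) = n" using dist len distinct_card[OF dist] by (simp add: zs_xs)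
  define P where "P = (\<Prod>x\<in>set xs. [:- complex_of_real x, 1:])"
  have eq: "(\<Sum>y\<in>set xs - {x}. 1 / (x - y)) + (\<beta> + 1) / 2 / (x + 1) + (\<alpha> + 1) / 2 / (x - 1) = 0"
    if "x \<in> set xs" for x
    using zs(2) len that by (intro minimizer_equilibrium dist inI) (auto simp: zs_xs)
  note P = equilibrium_imp_ode[OF finite_set inI eq, folded P_def, unfolded card]
  have "jacobi_poly n \<alpha> \<beta> = smult (coeff (jacobi_poly n \<alpha> \<beta>) n) P"
    using P by (intro jacobi_solution_unique[OF assms(1,2)] jacobi_poly_ode jacobi_poly_degree_le) auto
  hence "proots (jacobi_poly n \<alpha> \<beta>) = proots P"
    using coeff_jacobi_poly_nonzero[OF assms(1,2)] by (metis proots_smult)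
  also have "\<dots> = (\<Sum>x\<in>set xs. {#complex_of_real x#})"
    unfolding P_def by (subst proots_prod) auto
  also have "\<dots> = mset zs"
    unfolding zs_xs using dist by (simp add: sum_unfold_sum_mset mset_set_set[OF dist])
  finally show ?thesis using zs_xs dist inI that by metis
qed


section \<open>Lifting systems from the segment to continua\<close>

text \<open>
  The projection of a connected set is an interval, and it contains \<open>-1\<close> and \<open>1\<close>.
\<close>

lemma continuum_Re_surj:
  assumes "K \<in> continua" "t \<in> {-1..1}"
  obtains z where "z \<in> K" "Re z = t"
proof -
  have "connected (Re ` K)"
    using assms(1) by (intro connected_continuous_image continuous_intros) (auto simp: continua_def)
  moreover have "-1 \<in> Re ` K" "1 \<in> Re ` K"
    using assms(1) by (force simp: continua_def)+
  ultimately have "t \<in> Re ` K"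
    using assms(2) unfolding connected_iff_interval by auto
  thus ?thesis using that by blast
qed

text \<open>
  The distance between two points is at least the distance between their real parts, so each
  logarithm in the energy can only grow when real points are lifted off the axis. In the case of
  equality of the energies all these logarithms are equal. The distances to \<open>-1\<close> alone then force
  all imaginary parts to vanish, as they enter with the positive weight \<open>(\<beta> + 1) / 2\<close>.
\<close>

lemma energy_vertical_lift:
  fixes xs :: "real list" and zs :: "complex list"
  assumes "\<alpha> > -1" "\<beta> > -1"
    and xs: "distinct xs" "set xs \<subseteq> {-1 <..< 1}" and Re: "map Re zs = xs"
  shows "energy \<alpha> \<beta> zs \<le> energy \<alpha> \<beta> (map of_real xs)"
    and "energy \<alpha> \<beta> zs = energy \<alpha> \<beta> (map of_real xs) \<Longrightarrow> zs = map of_real xs"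
proof -
  let ?n = "length xs"
  have len: "length zs = ?n" using Re by auto
  have Re_nth: "Re (zs ! i) = xs ! i" if "i < ?n" for i
    using that Re len by (metis nth_map)
  have in_I: "-1 < xs ! i" "xs ! i < 1" if "i < ?n" for i
    using xs(2) that nth_mem by fastforce+
  have fz: "distinct zs" "-1 \<notin> set zs" "1 \<notin> set zs"
  proof -
    show "distinct zs" using xs(1) Re by (metis distinct_map)
    show "-1 \<notin> set zs" "1 \<notin> set zs"
      using xs(2) unfolding Re[symmetric] by force+
  qed
  have diff: "ln \<bar>xs ! k - xs ! j\<bar> \<le> ln (cmod (zs ! k - zs ! j))" if "k < j" "j < ?n" for k j
  proof -
    have "\<bar>xs ! k - xs ! j\<bar> > 0" using that xs(1) by (auto simp: nth_eq_iff_index_eq)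
    moreover have "\<bar>xs ! k - xs ! j\<bar> \<le> cmod (zs ! k - zs ! j)"
      using that abs_Re_le_cmod[of "zs ! k - zs ! j"] by (simp add: Re_nth)
    ultimately show ?thesis by (metis ln_mono)
  qed
  have left: "ln \<bar>xs ! k + 1\<bar> \<le> ln (cmod (zs ! k + 1))" and
       right: "ln \<bar>xs ! k - 1\<bar> \<le> ln (cmod (zs ! k - 1))" if "k < ?n" for k
    using abs_Re_le_cmod[of "zs ! k + 1"] abs_Re_le_cmod[of "zs ! k - 1"] in_I[OF that]
    unfolding Re_nth[OF that] plus_complex.sel minus_complex.sel one_complex.sel
    by (intro ln_mono; linarith)+
  \<comment> \<open>\<open>?D\<close> and \<open>?F\<close> collect the nonnegative gains in the interaction and in the external field.\<close>
  let ?D = "\<Sum>j<?n. \<Sum>k<j. ln (cmod (zs ! k - zs ! j)) - ln \<bar>xs ! k - xs ! j\<bar>"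
  let ?F = "\<lambda>k. (\<beta> + 1) / 2 * (ln (cmod (zs ! k + 1)) - ln \<bar>xs ! k + 1\<bar>)
              + (\<alpha> + 1) / 2 * (ln (cmod (zs ! k - 1)) - ln \<bar>xs ! k - 1\<bar>)"
  define WZ where "WZ k = - ((\<beta> + 1) / 2) * ln (cmod (zs ! k + 1)) - (\<alpha> + 1) / 2 * ln (cmod (zs ! k - 1))" for k
  define WX where "WX k = - ((\<beta> + 1) / 2) * ln \<bar>xs ! k + 1\<bar> - (\<alpha> + 1) / 2 * ln \<bar>xs ! k - 1\<bar>" for k
  define PZ where "PZ = (\<Sum>j<?n. \<Sum>k<j. ln (cmod (zs ! k - zs ! j)))"
  define PX where "PX = (\<Sum>j<?n. \<Sum>k<j. ln \<bar>xs ! k - xs ! j\<bar>)"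
  have ez: "energy \<alpha> \<beta> zs = ereal (- PZ + (\<Sum>k<?n. WZ k))"
    unfolding energy_finite[OF fz] len PZ_def WZ_def ..
  have ex': "energy \<alpha> \<beta> (map of_real xs) = ereal (- PX + (\<Sum>k<?n. WX k))"
    unfolding energy_of_real[OF xs] PX_def WX_def ..
  have "?D = PZ - PX" unfolding PZ_def PX_def by (simp add: sum_subtractf)
  moreover have "?F k = WX k - WZ k" for k
    unfolding WZ_def WX_def by (simp add: algebra_simps)
  ultimately have ex: "energy \<alpha> \<beta> (map of_real xs) = ereal ((- PZ + (\<Sum>k<?n. WZ k)) + (?D + (\<Sum>k<?n. ?F k)))"
    unfolding ex' by (simp add: sum_subtractf)
  have D: "?D \<ge> 0" using diff by (intro sum_nonneg) auto
  have F: "?F k \<ge> 0" if "k < ?n" for k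
    using assms(1,2) left[OF that] right[OF that] by (intro add_nonneg_nonneg mult_nonneg_nonneg) auto
  have SF: "(\<Sum>k<?n. ?F k) \<ge> 0" by (intro sum_nonneg F) simp
  show "energy \<alpha> \<beta> zs \<le> energy \<alpha> \<beta> (map of_real xs)"
    unfolding ez ex using D SF by simp
  assume "energy \<alpha> \<beta> zs = energy \<alpha> \<beta> (map of_real xs)"
  hence "?D + (\<Sum>k<?n. ?F k) = 0" unfolding ez ex by simp
  hence "(\<Sum>k<?n. ?F k) = 0" using D SF by linarith
  hence F0: "?F k = 0" if "k < ?n" for k
    using that F by (subst (asm) sum_nonneg_eq_0_iff) auto
  show "zs = map of_real xs"
  proof (rule nth_equalityI)
    fix k assume "k < length zs"
    hence k: "k < ?n" using len by simp
    have "(\<beta> + 1) / 2 * (ln (cmod (zs ! k + 1)) - ln \<bar>xs ! k + 1\<bar>) = 0"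
      using F0[OF k] left[OF k] right[OF k] assms(1,2)
      by (subst (asm) add_nonneg_eq_0_iff) auto
    hence "ln (cmod (zs ! k + 1)) = ln \<bar>xs ! k + 1\<bar>" using assms(2) by auto
    moreover have "cmod (zs ! k + 1) > 0" "\<bar>xs ! k + 1\<bar> > 0"
      using Re_nth[OF k] in_I[OF k] by (auto simp: add_eq_0_iff2)
    ultimately have "cmod (zs ! k + 1) = \<bar>Re (zs ! k + 1)\<bar>"
      using Re_nth[OF k] by simp
    hence "Im (zs ! k + 1) = 0" 
      using cmod_power2[of "zs ! k + 1"] by simp
    thus "zs ! k = map of_real xs ! k"
      using k Re_nth[OF k] by (simp add: complex_eq_iff)
  qed (simp add: len)
qed

theorem theorem1:
  fixes \<alpha> \<beta> :: real and n :: nat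
  assumes "\<alpha> > -1" and "\<beta> > -1"
  shows "maxmin_energy \<alpha> \<beta> n < \<infinity> \<and>
    (\<exists>!X. maxmin_attained_at \<alpha> \<beta> n X) \<and>
    (\<forall>X. maxmin_attained_at \<alpha> \<beta> n X \<longleftrightarrow> X = proots (jacobi_poly n \<alpha> \<beta>)) \<and>
    (\<exists>K\<in>extremal_continua \<alpha> \<beta> n. minimizers \<alpha> \<beta> n K = {proots (jacobi_poly n \<alpha> \<beta>)})"
proof -
  let ?S = real_segment and ?J = "proots (jacobi_poly n \<alpha> \<beta>)"
  note S = real_segment_continuum
  obtain zs where zs: "zs \<in> systems n ?S" "energy \<alpha> \<beta> zs = min_energy \<alpha> \<beta> n ?S"
    using min_energy_attained[OF assms, of ?S n] S unfolding continua_def by blast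
  obtain xs :: "real list" where xs: "zs = map of_real xs" "distinct xs" "set xs \<subseteq> {-1 <..< 1}"
    and J: "mset zs = ?J"
    using segment_minimizer_zeros[OF assms zs] by blast
  have lift: "\<exists>ys \<in> systems n K. energy \<alpha> \<beta> ys \<le> min_energy \<alpha> \<beta> n ?S \<and>
      (energy \<alpha> \<beta> ys = min_energy \<alpha> \<beta> n ?S \<longrightarrow> ys = zs)" if K: "K \<in> continua" for K
  proof -
    have "\<exists>z. z \<in> K \<and> Re z = t" if "t \<in> set xs" for t
    proof -
      have "t \<in> {-1..1}" using xs(3) that by auto
      from continuum_Re_surj[OF K this] show ?thesis by blast
    qed
    then obtain f where f: "\<And>t. t \<in> set xs \<Longrightarrow> f t \<in> K \<and> Re (f t) = t" by metis
    have "map Re (map f xs) = xs" using f by (simp add: map_idI)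
    note raise = energy_vertical_lift[OF assms xs(2,3) this]
    have "map f xs \<in> systems n K" using f zs(1) by (auto simp: systems_def xs(1))
    thus ?thesis using raise zs(2) unfolding xs(1) by auto
  qed
  have le: "min_energy \<alpha> \<beta> n K \<le> min_energy \<alpha> \<beta> n ?S" if "K \<in> continua" for K
    using lift[OF that] unfolding min_energy_def by (meson INF_lower order.trans)
  hence max: "maxmin_energy \<alpha> \<beta> n = min_energy \<alpha> \<beta> n ?S"
    unfolding maxmin_energy_def by (intro antisym SUP_least SUP_upper S)
  have extremal: "?S \<in> extremal_continua \<alpha> \<beta> n" by (simp add: extremal_continua_def S max)
  have unique: "minimizers \<alpha> \<beta> n ?S = {?J}"
  proof
    show "minimizers \<alpha> \<beta> n ?S \<subseteq> {?J}"
      unfolding minimizers_def using segment_minimizer_zeros[OF assms] by blast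
    show "{?J} \<subseteq> minimizers \<alpha> \<beta> n ?S"
      unfolding minimizers_def using zs J by (auto intro!: image_eqI[of _ _ zs])
  qed
  have every: "?J \<in> minimizers \<alpha> \<beta> n K" if "K \<in> extremal_continua \<alpha> \<beta> n" for K
  proof -
    have K: "K \<in> continua" "min_energy \<alpha> \<beta> n K = min_energy \<alpha> \<beta> n ?S"
      using that by (auto simp: extremal_continua_def max)
    obtain ys where ys: "ys \<in> systems n K" "energy \<alpha> \<beta> ys \<le> min_energy \<alpha> \<beta> n ?S"
      and ys_eq: "energy \<alpha> \<beta> ys = min_energy \<alpha> \<beta> n ?S \<longrightarrow> ys = zs"
      using lift[OF K(1)] by blast
    have "min_energy \<alpha> \<beta> n K \<le> energy \<alpha> \<beta> ys"
      unfolding min_energy_def by (rule INF_lower[OF ys(1)])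
    hence "energy \<alpha> \<beta> ys = min_energy \<alpha> \<beta> n K" using ys(2) K(2) by simp
    moreover from this have "ys = zs" using ys_eq K(2) by simp
    ultimately show ?thesis unfolding minimizers_def using ys(1) J by (auto intro!: image_eqI[of _ _ zs])
  qed
  have attained: "maxmin_attained_at \<alpha> \<beta> n X \<longleftrightarrow> X = ?J" for X
    unfolding maxmin_attained_at_def using extremal unique every by blast
  have "maxmin_energy \<alpha> \<beta> n < \<infinity>"
    unfolding max by (rule min_energy_segment_finite[OF assms])
  thus ?thesis using extremal unique by (auto simp: attained)
qed

end
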